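(* Let $\mathfrak g$ be a Lie algebra with $\dim\mathcal Z(\mathfrak g)=1$. Pick any nonzero $Z\in\mathcal Z(\mathfrak g)$ and linear subspaces $\mathfrak X,\mathfrak Y\subseteq\mathfrak g$ such that $$\mathcal C_2\mathfrak g=\mathcal Z(\mathfrak g)\dotplus\mathfrak Y\quad\text{and}\quad \mathfrak g=\mathfrak X\dotplus\mathcal C(\mathcal C_2\mathfrak g:\mathfrak g)=\mathfrak X\dotplus\mathcal C(\mathfrak Y:\mathfrak g).$$ Then the following assertions hold: (1) The Lie bracket defines a duality pairing $[\cdot,\cdot]\colon\mathfrak X\times\mathfrak Y\to\mathcal Z(\mathfrak g)\simeq\mathbb K$. Moreover $\dim(\mathfrak g/\mathcal C(\mathcal C_2\mathfrak g:\mathfrak g))=\dim(\mathcal C_2\mathfrak g/\mathcal Z(\mathfrak g))$ and $\dim\mathcal C_2\mathfrak g+\dim\mathcal C(\mathcal C_2\mathfrak g:\mathfrak g)=\dim\mathfrak g+1$. (2) If $Y_1,\dots,Y_m$ is a basis of $\mathfrak Y$, then there exist a unique basis $X_1,\dots,X_m$ of $\mathfrak X$ and a unique basis $\gamma_1,\dots,\gamma_m$ of $\mathcal C(\mathcal C_2\mathfrak g:\mathfrak g)^\perp\subseteq\mathfrak g^*$ such that $[X_j,Y_k]=\delta_{jk}Z$ and $[X,Y_k]=\gamma_k(X)Z$ for all $j,k\in\{1,\dots,m\}$ and $X\in\mathfrak g$. (3) We have $[\mathfrak g,\mathfrak g]\subseteq\mathcal C(\mathcal C_2\mathfrak g:\mathfrak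 g)$, and $\mathcal C(\mathcal C_2\mathfrak g:\mathfrak g)$ is a characteristic ideal of $\mathfrak g$.
   Context: $\mathbb K$ is an arbitrary field of characteristic different from $2$; all vector spaces and Lie algebras are finite-dimensional over $\mathbb K$. The symbol $\dotplus$ denotes direct sum of vector (sub)spaces. For a Lie algebra $\mathfrak g$: $\mathcal Z(\mathfrak g)=\{X\in\mathfrak g\mid[\mathfrak g,X]=0\}$ is the center; $\mathcal C_2\mathfrak g=\{X\in\mathfrak g\mid[\mathfrak g,[\mathfrak g,X]]=0\}$ is the second center; and for a subset $\mathfrak a\subseteq\mathfrak g$, $\mathcal C(\mathfrak a:\mathfrak g)=\{X\in\mathfrak g\mid[\mathfrak a,X]=0\}$ is its centralizer. A duality pairing is a nondegenerate bilinear map to $\mathbb K$ (nondegenerate in both variables; the spaces may be zero); $\mathcal Z(\mathfrak g)$ is identified with $\mathbb K$ by a choice of a nonzero element. For a subspace $W\subseteq\mathfrak g$, $W^\perp=\{\gamma\in\mathfrak g^*\mid\gamma|_W=0\}$. A characteristic ideal is an ideal invariant under all derivations of $\mathfrak g$. *)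

theory Defs
  imports Complex_Main "HOL-Library.Function_Algebras" "HOL-Library.Set_Algebras"
begin

definition direct_sum :: "'g::ab_group_add set \<Rightarrow> 'g set \<Rightarrow> 'g set \<Rightarrow> bool" where
  "direct_sum U V W \<longleftrightarrow> U = {v + w |v w. v \<in> V \<and> w \<in> W} \<and> V \<inter> W = {0}"

definition ordered_basis ::
  "('k::field \<Rightarrow> 'g::ab_group_add \<Rightarrow> 'g) \<Rightarrow> 'g set \<Rightarrow> 'g list \<Rightarrow> bool" where
  "ordered_basis scale V bs \<longleftrightarrow>
     distinct bs \<and> \<not> module.dependent scale (set bs) \<and> module.span scale (set bs) = V"

text \<open>The quotient \<open>V/W\<close> is the set of cosets. Its addition is the sum of sets, its zero is \<open>W\<close>,
  and \<open>c (x + W)\<close> is \<open>c x + W\<close>; adding \<open>W\<close> in \<open>coset_scale\<close> matters only for \<open>c = 0\<close>, and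
  in \<open>coset_combination\<close> only for the empty family, where \<open>sum\<close> would give \<open>{0}\<close>.\<close>

definition cosets :: "'g::ab_group_add set \<Rightarrow> 'g set \<Rightarrow> 'g set set" where
  "cosets V W = (\<lambda>x. x +o W) ` V"

definition coset_scale ::
  "('k::field \<Rightarrow> 'g::ab_group_add \<Rightarrow> 'g) \<Rightarrow> 'g set \<Rightarrow> 'k \<Rightarrow> 'g set \<Rightarrow> 'g set" where
  "coset_scale scale W c A = scale c ` A + W"

definition coset_combination ::
  "('k::field \<Rightarrow> 'g::ab_group_add \<Rightarrow> 'g) \<Rightarrow> 'g set \<Rightarrow> 'g set set \<Rightarrow> ('g set \<Rightarrow> 'k) \<Rightarrow> 'g set" where
  "coset_combination scale W B c = W + (\<Sum>A\<in>B. coset_scale scale W (c A) A)"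

definition quotient_basis ::
  "('k::field \<Rightarrow> 'g::ab_group_add \<Rightarrow> 'g) \<Rightarrow> 'g set \<Rightarrow> 'g set \<Rightarrow> 'g set set \<Rightarrow> bool" where
  "quotient_basis scale V W B \<longleftrightarrow> finite B \<and> B \<subseteq> cosets V W \<and>
     (\<forall>c. coset_combination scale W B c = W \<longrightarrow> (\<forall>A\<in>B. c A = 0)) \<and>
     (\<forall>Q\<in>cosets V W. \<exists>c. Q = coset_combination scale W B c)"

definition quotient_dim ::
  "('k::field \<Rightarrow> 'g::ab_group_add \<Rightarrow> 'g) \<Rightarrow> 'g set \<Rightarrow> 'g set \<Rightarrow> nat" where
  "quotient_dim scale V W = (THE n. \<exists>B. quotient_basis scale V W B \<and> card B = n)"

lemma (in vector_space) coset_combination_eq: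
  assumes W: "subspace W" and B: "finite B" "\<And>A. A \<in> B \<Longrightarrow> A = r A +o W"
  shows "coset_combination scale W B c = (\<Sum>A\<in>B. scale (c A) (r A)) +o W"
  using B
proof (induction B rule: finite_induct)
  case empty
  show ?case by (simp add: coset_combination_def elt_set_plus_def set_plus_def)
next
  case (insert A B)
  have WW: "W + W = W"
    using subspace_add[OF W] subspace_0[OF W] by (force simp: set_plus_def)
  have sc: "coset_scale scale W (c A) A = scale (c A) (r A) +o W"
  proof -
    have A: "A = r A +o W" using insert.prems by blast
    have "scale (c A) ` (r A +o W) + W = scale (c A) (r A) +o W" (is "?L = ?R")
    proof
      show "?L \<subseteq> ?R"
        using subspace_add[OF W] subspace_scale[OF W]
        by (force simp: set_plus_def elt_set_plus_def scale_right_distrib add.assoc)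
      show "?R \<subseteq> ?L"
      proof
        fix v assume "v \<in> ?R"
        then obtain w where w: "w \<in> W" "v = scale (c A) (r A) + w"
          by (auto simp: elt_set_plus_def)
        have "r A \<in> r A +o W" using subspace_0[OF W] by (force simp: elt_set_plus_def)
        then show "v \<in> ?L" using w by (auto simp: set_plus_def)
      qed
    qed
    then show ?thesis unfolding coset_scale_def using A by simp
  qed
  have IH: "W + (\<Sum>A\<in>B. coset_scale scale W (c A) A) = (\<Sum>A\<in>B. scale (c A) (r A)) +o W"
    using insert unfolding coset_combination_def by blast
  have "coset_combination scale W (insert A B) c
      = coset_scale scale W (c A) A + (W + (\<Sum>A\<in>B. coset_scale scale W (c A) A))"
    using insert.hyps by (simp add: coset_combination_def add.left_commute)
  also have "\<dots> = (scale (c A) (r A) +o W) + ((\<Sum>A\<in>B. scale (c A) (r A)) +o W)"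
    by (simp only: sc IH)
  also have "\<dots> = (scale (c A) (r A) + (\<Sum>A\<in>B. scale (c A) (r A))) +o (W + W)"
    by (simp add: set_plus_rearrange)
  finally show ?case using insert.hyps WW by simp
qed

lemma (in vector_space) coset_eq_iff:
  assumes W: "subspace W"
  shows "x +o W = y +o W \<longleftrightarrow> x - y \<in> W"
proof
  assume "x +o W = y +o W"
  moreover have "x \<in> x +o W" using subspace_0[OF W] by (force simp: elt_set_plus_def)
  ultimately obtain w where "w \<in> W" "x = y + w" by (auto simp: elt_set_plus_def)
  then show "x - y \<in> W" by simp
next
  assume d: "x - y \<in> W"
  have "x + w = y + ((x - y) + w)" "y + w = x + (w - (x - y))" for w by simp_all
  then show "x +o W = y +o W"
    unfolding elt_set_plus_def
    using subspace_add[OF W d] subspace_diff[OF W _ d] by blast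
qed

lemma (in vector_space) card_quotient_basis:
  assumes V: "subspace V" and W: "subspace W" and WV: "W \<subseteq> V" and F: "finite F" "V \<subseteq> span F"
    and B: "quotient_basis scale V W B"
  shows "card B + dim W = dim V"
proof -
  from B have fB: "finite B" and BV: "B \<subseteq> cosets V W"
    and ind: "\<And>c A. coset_combination scale W B c = W \<Longrightarrow> A \<in> B \<Longrightarrow> c A = 0"
    and spn: "\<And>Q. Q \<in> cosets V W \<Longrightarrow> \<exists>c. Q = coset_combination scale W B c"
    by (auto simp: quotient_basis_def)
  have "\<forall>A\<in>B. \<exists>x. x \<in> V \<and> A = x +o W" using BV by (auto simp: cosets_def)
  then obtain r where r: "\<And>A. A \<in> B \<Longrightarrow> r A \<in> V \<and> A = r A +o W" by metis
  have comb: "coset_combination scale W B c = (\<Sum>A\<in>B. scale (c A) (r A)) +o W" for c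
    by (rule coset_combination_eq[OF W fB]) (use r in blast)
  have comb0: "c A = 0" if "(\<Sum>A\<in>B. scale (c A) (r A)) \<in> W" "A \<in> B" for c A
    by (rule ind[OF _ that(2)])
      (use coset_eq_iff[OF W, of "\<Sum>A\<in>B. scale (c A) (r A)" 0] that(1) in \<open>simp add: comb\<close>)
  obtain C where C: "C \<subseteq> W" "independent C" "W \<subseteq> span C" "card C = dim W"
    by (rule basis_exists)
  have fC: "finite C"
    using independent_span_bound[OF F(1) C(2)] C(1) WV F(2) by blast
  have inj: "inj_on r B" using r by (metis inj_onI)
  have disj: "r ` B \<inter> C = {}"
  proof (rule ccontr)
    assume "r ` B \<inter> C \<noteq> {}"
    then obtain A where A: "A \<in> B" "r A \<in> W" using C(1) by blast
    have "(\<Sum>A'\<in>B. scale (if A' = A then 1 else 0) (r A')) = (\<Sum>A'\<in>B. if A' = A then r A else 0)"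
      by (intro sum.cong) auto
    also have "\<dots> = r A" using A fB by simp
    finally have "(if A = A then 1 else 0::'a) = 0"
      using comb0[of "\<lambda>A'. if A' = A then 1 else 0" A] A by simp
    then show False by simp
  qed
  have indU: "independent (r ` B \<union> C)"
  proof (rule independent_if_scalars_zero)
    show "finite (r ` B \<union> C)" using fB fC by simp
    fix f x assume s: "(\<Sum>x\<in>r ` B \<union> C. scale (f x) x) = 0" and x: "x \<in> r ` B \<union> C"
    have split: "(\<Sum>A\<in>B. scale (f (r A)) (r A)) + (\<Sum>x\<in>C. scale (f x) x) = 0"
      using s fB fC disj by (simp add: sum.union_disjoint sum.reindex[OF inj] o_def)
    have CW: "(\<Sum>x\<in>C. scale (f x) x) \<in> W"
      using C(1) by (intro subspace_sum[OF W] subspace_scale[OF W]) auto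
    have "(\<Sum>A\<in>B. scale (f (r A)) (r A)) = - (\<Sum>x\<in>C. scale (f x) x)"
      using split by (simp add: eq_neg_iff_add_eq_0)
    then have "(\<Sum>A\<in>B. scale (f (r A)) (r A)) \<in> W" using subspace_neg[OF W CW] by simp
    from comb0[of "\<lambda>A. f (r A)", OF this] have z: "\<And>A. A \<in> B \<Longrightarrow> f (r A) = 0" .
    then have "(\<Sum>x\<in>C. scale (f x) x) = 0" using split by simp
    then have "\<forall>x\<in>C. f x = 0" using C(2) unfolding dependent_finite[OF fC] by blast
    then show "f x = 0" using x z by auto
  qed
  have sp: "V \<subseteq> span (r ` B \<union> C)"
  proof
    fix v assume v: "v \<in> V"
    then obtain c where "v +o W = (\<Sum>A\<in>B. scale (c A) (r A)) +o W"
      using spn comb by (metis cosets_def imageI)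
    then have "v - (\<Sum>A\<in>B. scale (c A) (r A)) \<in> span C"
      using C(3) coset_eq_iff[OF W] by blast
    then have "v - (\<Sum>A\<in>B. scale (c A) (r A)) \<in> span (r ` B \<union> C)"
      using span_mono[of C "r ` B \<union> C"] by blast
    moreover have "(\<Sum>A\<in>B. scale (c A) (r A)) \<in> span (r ` B \<union> C)"
      by (intro span_sum span_scale span_base) auto
    ultimately show "v \<in> span (r ` B \<union> C)" by (metis diff_add_cancel span_add)
  qed
  have "r ` B \<union> C \<subseteq> V" using r C(1) WV by auto
  then have "card (r ` B \<union> C) = dim V" using basis_card_eq_dim sp indU by blast
  then show ?thesis
    using disj fB fC C(4) by (simp add: card_Un_disjoint card_image[OF inj])
qed

lemma (in vector_space) quotient_basis_exists:
  assumes V: "subspace V" and W: "subspace W" and WV: "W \<subseteq> V" and F: "finite F" "V \<subseteq> span F"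
  shows "\<exists>B. quotient_basis scale V W B"
proof -
  obtain C where C: "C \<subseteq> W" "independent C" "W \<subseteq> span C" by (rule maximal_independent_subset)
  obtain E where E: "C \<subseteq> E" "E \<subseteq> V" "independent E" "V \<subseteq> span E"
    by (rule maximal_independent_subset_extend[of C V]) (use C WV in auto)
  have fE: "finite E" using independent_span_bound[OF F(1) E(3)] E(2) F(2) by blast
  define D where "D = E - C"
  have fD: "finite D" using fE by (simp add: D_def)
  have fC: "finite C" using fE E(1) finite_subset by blast
  have spW: "span C = W" using C span_minimal[OF C(1) W] by blast
  have D0: "\<forall>x\<in>D. c x = 0" if "(\<Sum>x\<in>D. scale (c x) x) \<in> W" for c
  proof -
    from that spW obtain u where u: "(\<Sum>x\<in>D. scale (c x) x) = (\<Sum>x\<in>C. scale (u x) x)"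
      using span_finite[OF fC] by auto
    define f where "f x = (if x \<in> C then - u x else c x)" for x
    have "(\<Sum>x\<in>E. scale (f x) x) = (\<Sum>x\<in>D. scale (f x) x) + (\<Sum>x\<in>C. scale (f x) x)"
      unfolding D_def by (rule sum.subset_diff[OF E(1) fE])
    also have "(\<Sum>x\<in>D. scale (f x) x) = (\<Sum>x\<in>D. scale (c x) x)"
      by (intro sum.cong) (auto simp: f_def D_def)
    also have "(\<Sum>x\<in>C. scale (f x) x) = - (\<Sum>x\<in>C. scale (u x) x)"
      unfolding sum_negf[symmetric] by (intro sum.cong) (auto simp: f_def)
    finally have "(\<Sum>x\<in>E. scale (f x) x) = 0" using u by simp
    then have "\<forall>x\<in>E. f x = 0" using E(3) unfolding dependent_finite[OF fE] by blast
    then show ?thesis by (auto simp: f_def D_def)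
  qed
  define p where "p x = x +o W" for x
  have inj: "inj_on p D"
  proof (rule inj_onI, rule ccontr)
    fix x y assume xy: "x \<in> D" "y \<in> D" "p x = p y" "x \<noteq> y"
    define c where "c z = (if z = x then 1 else if z = y then -1 else 0 :: 'a)" for z
    have "(\<Sum>z\<in>D. scale (c z) z) = (\<Sum>z\<in>D. (if z = x then x else 0) - (if z = y then y else 0))"
      by (intro sum.cong) (use xy in \<open>auto simp: c_def\<close>)
    also have "\<dots> = x - y" using xy fD by (simp add: sum_subtractf)
    also have "\<dots> \<in> W" using xy coset_eq_iff[OF W] by (simp add: p_def)
    finally have "c x = 0" using D0 xy by blast
    then show False by (simp add: c_def)
  qed
  define r where "r = inv_into D p"
  have rp: "r (p x) = x" if "x \<in> D" for x using that inj by (simp add: r_def)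
  have comb: "coset_combination scale W (p ` D) c = (\<Sum>x\<in>D. scale (c (p x)) x) +o W" for c
  proof -
    have "coset_combination scale W (p ` D) c = (\<Sum>A\<in>p ` D. scale (c A) (r A)) +o W"
      by (rule coset_combination_eq[OF W]) (use fD rp in \<open>auto simp: p_def\<close>)
    also have "(\<Sum>A\<in>p ` D. scale (c A) (r A)) = (\<Sum>x\<in>D. scale (c (p x)) x)"
      unfolding sum.reindex[OF inj] by (intro sum.cong) (auto simp: rp)
    finally show ?thesis .
  qed
  have "quotient_basis scale V W (p ` D)"
    unfolding quotient_basis_def
  proof (intro conjI allI impI ballI)
    show "finite (p ` D)" using fD by simp
    show "p ` D \<subseteq> cosets V W" using E(2) by (auto simp: p_def cosets_def D_def)
  next
    fix c A assume a: "coset_combination scale W (p ` D) c = W" "A \<in> p ` D"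
    then have "(\<Sum>x\<in>D. scale (c (p x)) x) +o W = 0 +o W" by (simp add: comb)
    then have "(\<Sum>x\<in>D. scale (c (p x)) x) \<in> W" using coset_eq_iff[OF W] by fastforce
    from D0[of "\<lambda>x. c (p x)", OF this] show "c A = 0" using a(2) by auto
  next
    fix Q assume "Q \<in> cosets V W"
    then obtain v where v: "v \<in> V" "Q = v +o W" by (auto simp: cosets_def)
    then obtain u where u: "v = (\<Sum>x\<in>E. scale (u x) x)"
      using E(4) span_finite[OF fE] by auto
    have "v = (\<Sum>x\<in>D. scale (u x) x) + (\<Sum>x\<in>C. scale (u x) x)"
      unfolding D_def u by (rule sum.subset_diff[OF E(1) fE])
    moreover have "(\<Sum>x\<in>C. scale (u x) x) \<in> W"
      using C(1) by (intro subspace_sum[OF W] subspace_scale[OF W]) auto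
    ultimately have "v - (\<Sum>x\<in>D. scale (u x) x) \<in> W" by simp
    moreover have "(\<Sum>x\<in>D. scale (u (r (p x))) x) = (\<Sum>x\<in>D. scale (u x) x)"
      by (intro sum.cong) (auto simp: rp)
    ultimately have "Q = coset_combination scale W (p ` D) (\<lambda>A. u (r A))"
      using coset_eq_iff[OF W] by (simp add: comb v)
    then show "\<exists>c. Q = coset_combination scale W (p ` D) c" by blast
  qed
  then show ?thesis by blast
qed

lemma (in vector_space) quotient_dim_eq:
  assumes V: "subspace V" and W: "subspace W" and WV: "W \<subseteq> V" and F: "finite F" "V \<subseteq> span F"
  shows "quotient_dim scale V W + dim W = dim V"
proof -
  obtain B where B: "quotient_basis scale V W B"
    using quotient_basis_exists[OF assms] by blast
  have "quotient_dim scale V W = card B"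
    unfolding quotient_dim_def
  proof (rule the_equality)
    show "\<exists>B'. quotient_basis scale V W B' \<and> card B' = card B" using B by blast
    fix n assume "\<exists>B'. quotient_basis scale V W B' \<and> card B' = n"
    then show "n = card B"
      using card_quotient_basis[OF assms] B by (metis add_right_cancel)
  qed
  then show ?thesis using card_quotient_basis[OF assms B] by simp
qed

text \<open>Linear functionals live in the function space with pointwise operations.\<close>

definition dual_scale :: "'k::field \<Rightarrow> ('g \<Rightarrow> 'k) \<Rightarrow> 'g \<Rightarrow> 'k" where
  "dual_scale c \<gamma> = (\<lambda>x. c * \<gamma> x)"

interpretation dual: vector_space dual_scale
  by unfold_locales (auto simp: dual_scale_def algebra_simps)

definition annihilator ::
  "('k::field \<Rightarrow> 'g::ab_group_add \<Rightarrow> 'g) \<Rightarrow> 'g set \<Rightarrow> ('g \<Rightarrow> 'k) set" where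
  "annihilator scale W = {\<gamma>. Vector_Spaces.linear scale (*) \<gamma> \<and> (\<forall>x\<in>W. \<gamma> x = 0)}"

definition duality_pairing ::
  "('k::field \<Rightarrow> 'g::ab_group_add \<Rightarrow> 'g) \<Rightarrow> 'g set \<Rightarrow> 'g set \<Rightarrow> ('g \<Rightarrow> 'g \<Rightarrow> 'k) \<Rightarrow> bool" where
  "duality_pairing scale V W \<beta> \<longleftrightarrow>
     (\<forall>x\<in>V. \<forall>x'\<in>V. \<forall>y\<in>W. \<beta> (x + x') y = \<beta> x y + \<beta> x' y) \<and>
     (\<forall>x\<in>V. \<forall>y\<in>W. \<forall>y'\<in>W. \<beta> x (y + y') = \<beta> x y + \<beta> x y') \<and>
     (\<forall>c. \<forall>x\<in>V. \<forall>y\<in>W. \<beta> (scale c x) y = c * \<beta> x y \<and> \<beta> x (scale c y) = c * \<beta> x y) \<and>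
     (\<forall>x\<in>V. (\<forall>y\<in>W. \<beta> x y = 0) \<longrightarrow> x = 0) \<and>
     (\<forall>y\<in>W. (\<forall>x\<in>V. \<beta> x y = 0) \<longrightarrow> y = 0)"

text \<open>The inverse of the isomorphism \<open>c \<mapsto> c z\<close> from the field onto the line spanned by \<open>z \<noteq> 0\<close>.\<close>

definition line_coord :: "('k::field \<Rightarrow> 'g::ab_group_add \<Rightarrow> 'g) \<Rightarrow> 'g \<Rightarrow> 'g \<Rightarrow> 'k" where
  "line_coord scale z v = (THE c. v = scale c z)"

text \<open>The Lie algebra is the whole type \<open>'g\<close>.\<close>

locale fd_lie_algebra = vector_space scale
  for scale :: "'k::field \<Rightarrow> 'g::ab_group_add \<Rightarrow> 'g" +
  fixes bracket :: "'g \<Rightarrow> 'g \<Rightarrow> 'g"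
  assumes linear_left: "Vector_Spaces.linear scale scale (\<lambda>x. bracket x y)"
    and linear_right: "Vector_Spaces.linear scale scale (\<lambda>y. bracket x y)"
    and alternating: "bracket x x = 0"
    and jacobi: "bracket x (bracket y z) + bracket y (bracket z x) + bracket z (bracket x y) = 0"
    and finite_dim: "\<exists>B. finite B \<and> span B = UNIV"

definition lie_center :: "('g::ab_group_add \<Rightarrow> 'g \<Rightarrow> 'g) \<Rightarrow> 'g set" where
  "lie_center bracket = {x. \<forall>a. bracket a x = 0}"

definition second_center :: "('g::ab_group_add \<Rightarrow> 'g \<Rightarrow> 'g) \<Rightarrow> 'g set" where
  "second_center bracket = {x. \<forall>a b. bracket a (bracket b x) = 0}"

definition lie_centralizer :: "('g::ab_group_add \<Rightarrow> 'g \<Rightarrow> 'g) \<Rightarrow> 'g set \<Rightarrow> 'g set" where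
  "lie_centralizer bracket S = {x. \<forall>a\<in>S. bracket a x = 0}"

definition derived_algebra ::
  "('k::field \<Rightarrow> 'g::ab_group_add \<Rightarrow> 'g) \<Rightarrow> ('g \<Rightarrow> 'g \<Rightarrow> 'g) \<Rightarrow> 'g set" where
  "derived_algebra scale bracket = module.span scale {bracket x y |x y. True}"

definition lie_ideal ::
  "('k::field \<Rightarrow> 'g::ab_group_add \<Rightarrow> 'g) \<Rightarrow> ('g \<Rightarrow> 'g \<Rightarrow> 'g) \<Rightarrow> 'g set \<Rightarrow> bool" where
  "lie_ideal scale bracket I \<longleftrightarrow> module.subspace scale I \<and> (\<forall>a. \<forall>x\<in>I. bracket a x \<in> I)"

definition derivation ::
  "('k::field \<Rightarrow> 'g::ab_group_add \<Rightarrow> 'g) \<Rightarrow> ('g \<Rightarrow> 'g \<Rightarrow> 'g) \<Rightarrow> ('g \<Rightarrow> 'g) \<Rightarrow> bool" where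
  "derivation scale bracket D \<longleftrightarrow> Vector_Spaces.linear scale scale D \<and>
     (\<forall>x y. D (bracket x y) = bracket (D x) y + bracket x (D y))"

definition characteristic_ideal ::
  "('k::field \<Rightarrow> 'g::ab_group_add \<Rightarrow> 'g) \<Rightarrow> ('g \<Rightarrow> 'g \<Rightarrow> 'g) \<Rightarrow> 'g set \<Rightarrow> bool" where
  "characteristic_ideal scale bracket I \<longleftrightarrow> lie_ideal scale bracket I \<and>
     (\<forall>D. derivation scale bracket D \<longrightarrow> D ` I \<subseteq> I)"

end

theory Submission
  imports Defs
begin

text \<open>Bracketing with a second-central element takes values in the line spanned by \<open>Z\<close>, so every
  \<open>y \<in> Y\<close> gives a linear functional \<open>x \<mapsto> [x, y]\<close> on the whole algebra. For a basis of \<open>Y\<close>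
  these functionals are independent on \<open>X\<close> and their common kernel is the centralizer of the
  second center, which meets \<open>X\<close> trivially. Hence they have a biorthogonal family in \<open>X\<close>, and
  biorthogonality makes that family a basis of \<open>X\<close> and the functionals a basis of the annihilator.
  The Jacobi identity gives the last part.\<close>

section \<open>Linear functionals and bases given as lists\<close>

lemma vector_space_mult: "vector_space ((*) :: 'k::field \<Rightarrow> 'k \<Rightarrow> 'k)"
  by unfold_locales (auto simp: algebra_simps)

lemma ordered_basis_nth_mem:
  assumes "vector_space scale" and "ordered_basis scale V bs" and "k < length bs"
  shows "bs ! k \<in> V"
proof -
  interpret vector_space scale by fact
  show ?thesis
    using assms(2,3) span_base[of "bs ! k" "set bs"] by (auto simp: ordered_basis_def)
qed

context vector_space
begin

lemma functional_iff:
  "Vector_Spaces.linear scale (*) f \<longleftrightarrow>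
    (\<forall>x y. f (x + y) = f x + f y) \<and> (\<forall>c x. f (scale c x) = c * f x)"
  using vector_space_axioms by (simp add: Vector_Spaces.linear_iff vector_space_mult)

lemma
  assumes "Vector_Spaces.linear scale (*) f"
  shows functional_add: "f (x + y) = f x + f y"
    and functional_scale: "f (scale c x) = c * f x"
    and functional_zero: "f 0 = 0"
    and functional_diff: "f (x - y) = f x - f y"
    and functional_sum: "f (\<Sum>i\<in>I. g i) = (\<Sum>i\<in>I. f (g i))"
proof -
  interpret f: Vector_Spaces.linear scale "(*)" f by fact
  show "f (x + y) = f x + f y" "f (scale c x) = c * f x" "f 0 = 0" "f (x - y) = f x - f y"
    "f (\<Sum>i\<in>I. g i) = (\<Sum>i\<in>I. f (g i))"
    by (rule f.add f.scale f.zero f.diff f.sum)+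
qed

lemma ordered_basis_exists:
  assumes "finite F" and "span F = UNIV" and "subspace V"
  obtains bs where "ordered_basis scale V bs"
proof -
  obtain B where B: "B \<subseteq> V" "independent B" "V \<subseteq> span B" by (rule maximal_independent_subset)
  have "finite B" using independent_span_bound[OF assms(1) B(2)] assms(2) by auto
  then obtain bs where "set bs = B" "distinct bs" using finite_distinct_list by blast
  moreover have "span B = V" using B span_minimal[OF B(1) assms(3)] by blast
  ultimately show thesis using that B by (auto simp: ordered_basis_def)
qed

lemma length_ordered_basis:
  assumes "ordered_basis scale V bs"
  shows "length bs = dim V"
  using assms dim_eq_card_independent[of "set bs"]
  by (auto simp: ordered_basis_def distinct_card)

text \<open>Independence is stated for the set of entries. As the entries are distinct, coefficients
  indexed by positions can be moved to coefficients indexed by vectors, where independence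
  applies.\<close>

lemma ordered_basis_coeff_zero:
  assumes bs: "ordered_basis scale V bs"
    and zero: "(\<Sum>k<length bs. scale (c k) (bs ! k)) = 0" and k: "k < length bs"
  shows "c k = 0"
proof -
  have bij: "bij_betw ((!) bs) {..<length bs} (set bs)"
    using bs by (intro bij_betw_nth) (auto simp: ordered_basis_def)
  define u where "u = c \<circ> inv_into {..<length bs} ((!) bs)"
  have u: "u (bs ! i) = c i" if "i < length bs" for i
    using bij that by (simp add: u_def bij_betw_inv_into_left)
  have "(\<Sum>v\<in>set bs. scale (u v) v) = (\<Sum>k<length bs. scale (u (bs ! k)) (bs ! k))"
    by (rule sum.reindex_bij_betw[OF bij, symmetric])
  also have "\<dots> = 0" using u zero by simp
  finally have "\<forall>v\<in>set bs. u v = 0"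
    using bs dependent_finite[of "set bs"] by (auto simp: ordered_basis_def)
  then show ?thesis using u[OF k] k by force
qed

section \<open>Biorthogonal families of vectors and functionals\<close>

lemma functional_biorthogonal_combination:
  fixes m :: nat
  assumes f: "\<And>k. k < m \<Longrightarrow> Vector_Spaces.linear scale (*) (f k)"
    and xs: "\<And>j k. j < m \<Longrightarrow> k < m \<Longrightarrow> f k (x j) = (if j = k then 1 else 0)"
    and k: "k < m"
  shows "f k (v - (\<Sum>j<m. scale (f j v) (x j))) = 0"
proof -
  \<comment> \<open>Only the term \<open>j = k\<close> survives, so \<open>f k\<close> takes the
    same value on the sum as on \<open>v\<close>. Subtracting the sum thus projects onto the common
    kernel of the functionals, along the span of the \<open>x j\<close>.\<close>
  have "(\<Sum>j<m. f j v * f k (x j)) = (\<Sum>j<m. if j = k then f j v else 0)"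
    using xs k by (intro sum.cong) auto
  then show ?thesis
    using k by (simp add: functional_diff[OF f] functional_sum[OF f] functional_scale[OF f])
qed

text \<open>Independence: \<open>f k\<close> vanishes on all other entries, hence on their span, but
  equals 1 on entry \<open>k\<close>. Spanning: the projection of \<open>v\<close> to the common
  kernel stays in \<open>V\<close>, so nondegeneracy makes it zero and \<open>v\<close> equals the
  subtracted combination. This is applied once to vectors in the algebra and once to functionals in
  the dual space.\<close>

lemma ordered_basis_biorthogonal:
  assumes V: "subspace V" and xs: "set xs \<subseteq> V"
    and f: "\<And>k. k < length xs \<Longrightarrow> Vector_Spaces.linear scale (*) (f k)"
    and bi: "\<And>j k. j < length xs \<Longrightarrow> k < length xs \<Longrightarrow> f k (xs ! j) = (if j = k then 1 else 0)"
    and nondeg: "\<And>v. v \<in> V \<Longrightarrow> (\<And>k. k < length xs \<Longrightarrow> f k v = 0) \<Longrightarrow> v = 0"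
  shows "ordered_basis scale V xs"
  unfolding ordered_basis_def
proof (intro conjI)
  show "distinct xs"
    unfolding distinct_conv_nth by (metis bi zero_neq_one)
  show "independent (set xs)"
    unfolding dependent_def
  proof (rule notI, elim bexE)
    fix a assume "a \<in> set xs" and a: "a \<in> span (set xs - {a})"
    then obtain k where k: "k < length xs" "xs ! k = a" by (auto simp: in_set_conv_nth)
    have "set xs - {a} \<subseteq> {v. f k v = 0}" using k bi by (auto simp: in_set_conv_nth)
    moreover have "subspace {v. f k v = 0}"
      using f[OF k(1)] by (intro subspaceI) (auto simp: functional_add functional_zero functional_scale)
    ultimately have "f k a = 0" using a span_minimal by blast
    then show False using bi[OF k(1) k(1)] k(2) by simp
  qed
  show "span (set xs) = V"
  proof
    show "span (set xs) \<subseteq> V" by (rule span_minimal[OF xs V])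
    show "V \<subseteq> span (set xs)"
    proof
      fix v assume v: "v \<in> V"
      let ?s = "\<Sum>j<length xs. scale (f j v) (xs ! j)"
      have "?s \<in> V"
        using xs by (intro subspace_sum[OF V] subspace_scale[OF V]) auto
      then have "v - ?s = 0"
        using functional_biorthogonal_combination[where x = "(!) xs", OF f bi]
        by (intro nondeg subspace_diff[OF V] v) auto
      moreover have "?s \<in> span (set xs)" by (intro span_sum span_scale span_base) auto
      ultimately show "v \<in> span (set xs)" by simp
    qed
  qed
qed

text \<open>The hypothesis \<open>ind\<close> says that the restrictions of the functionals to
  \<open>V\<close> are independent. The family is built by induction in the manner of Gram-Schmidt:
  find a vector seen by the last functional only, then correct the earlier vectors by multiples of
  it.\<close>

lemma biorthogonal_family_exists:
  fixes m :: nat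
  assumes V: "subspace V"
    and f: "\<And>k. k < m \<Longrightarrow> Vector_Spaces.linear scale (*) (f k)"
    and ind: "\<And>c k. (\<And>x. x \<in> V \<Longrightarrow> (\<Sum>k<m. c k * f k x) = 0) \<Longrightarrow> k < m \<Longrightarrow> c k = 0"
  shows "\<exists>x. \<forall>j<m. x j \<in> V \<and> (\<forall>k<m. f k (x j) = (if j = k then 1 else 0))"
  using f ind
proof (induction m)
  case 0
  show ?case by simp
next
  case (Suc m)
  \<comment> \<open>A relation among the first \<open>m\<close> functionals becomes one among
    \<open>Suc m\<close> by giving the last the coefficient 0, so the independence hypothesis passes
    to \<open>m\<close>.\<close>
  have "c k = 0" if c: "\<And>x. x \<in> V \<Longrightarrow> (\<Sum>k<m. c k * f k x) = 0" and k: "k < m" for c k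
    using Suc.prems(2)[of "c(m := 0)" k] c k by simp
  then have "\<exists>x. \<forall>j<m. x j \<in> V \<and> (\<forall>k<m. f k (x j) = (if j = k then 1 else 0))"
    by (intro Suc.IH Suc.prems(1)) auto
  then obtain x where "\<forall>j<m. x j \<in> V \<and> (\<forall>k<m. f k (x j) = (if j = k then 1 else 0))" ..
  then have x: "\<And>j. j < m \<Longrightarrow> x j \<in> V"
      "\<And>j k. j < m \<Longrightarrow> k < m \<Longrightarrow> f k (x j) = (if j = k then 1 else 0)"
    by blast+
  \<comment> \<open>Otherwise \<open>f m\<close> would vanish on the projection of every
    \<open>v\<close> in \<open>V\<close> to the common kernel of the earlier functionals. On
    \<open>V\<close> it would then be their combination with coefficients \<open>f m (x k)\<close>:
    a relation whose coefficient at \<open>m\<close> is 1.\<close>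
  have "\<exists>u\<in>V. f m u \<noteq> 0 \<and> (\<forall>k<m. f k u = 0)"
  proof (rule ccontr)
    assume no: "\<not> ?thesis"
    have "(\<Sum>k<Suc m. (if k = m then 1 else - f m (x k)) * f k v) = 0" if v: "v \<in> V" for v
    proof -
      let ?s = "\<Sum>j<m. scale (f j v) (x j)"
      have "v - ?s \<in> V"
        by (intro subspace_diff[OF V] subspace_sum[OF V] subspace_scale[OF V] v x) auto
      moreover have "f k (v - ?s) = 0" if "k < m" for k
        using functional_biorthogonal_combination[of m f x k v] Suc.prems(1) x(2) that by auto
      ultimately have "f m (v - ?s) = 0" using no by blast
      then have "f m v = (\<Sum>k<m. f m (x k) * f k v)"
        using Suc.prems(1)[of m]
        by (simp add: functional_diff functional_sum functional_scale mult.commute)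
      then show ?thesis by (simp add: sum_negf)
    qed
    from Suc.prems(2)[OF this, of m] show False by simp
  qed
  then obtain u where u: "u \<in> V" "f m u \<noteq> 0" "\<And>k. k < m \<Longrightarrow> f k u = 0" by blast
  define w where "w = scale (1 / f m u) u"
  have w: "w \<in> V" "f m w = 1" "\<And>k. k < m \<Longrightarrow> f k w = 0"
    using u subspace_scale[OF V] Suc.prems(1) by (auto simp: w_def functional_scale)
  \<comment> \<open>The subtraction makes \<open>f m\<close> vanish on the old vectors and leaves
    their values under the earlier functionals unchanged, since these vanish on
    \<open>w\<close>.\<close>
  define x' where "x' j = (if j = m then w else x j - scale (f m (x j)) w)" for j
  have "x' j \<in> V" if "j < Suc m" for j
    using that w(1) x(1) subspace_diff[OF V] subspace_scale[OF V] by (auto simp: x'_def less_Suc_eq)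
  moreover have "f k (x' j) = (if j = k then 1 else 0)" if "j < Suc m" "k < Suc m" for j k
    using that w x(2) Suc.prems(1)[of k]
    by (auto simp: x'_def less_Suc_eq functional_diff functional_scale)
  ultimately show ?case by blast
qed

lemma subspace_annihilator: "dual.subspace (annihilator scale W)"
  by (rule dual.subspaceI)
    (auto simp: annihilator_def functional_iff dual_scale_def algebra_simps)

end

lemma (in finite_dimensional_vector_space) dim_direct_sum:
  assumes "subspace V" and "subspace W" and "direct_sum U V W"
  shows "dim U = dim V + dim W"
  using dim_sums_Int[OF assms(1,2)] assms(3) by (simp add: direct_sum_def)

section \<open>Brackets, the second center and its centralizer\<close>

context fd_lie_algebra
begin

text \<open>The locale provides a finite spanning set only; an independent one is what an
  interpretation of \<open>finite_dimensional_vector_space\<close> asks for.\<close>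

lemma finite_basis_exists:
  obtains B where "finite B" and "independent B" and "span B = UNIV"
  using finite_dim maximal_independent_subset[of UNIV] independent_span_bound
  by (metis UNIV_I subsetI subset_antisym)

lemma bracket_add_left: "bracket (x + y) z = bracket x z + bracket y z"
  and bracket_scale_left: "bracket (scale c x) z = scale c (bracket x z)"
  using linear_left[of z] by (simp_all add: Vector_Spaces.linear_iff)

lemma bracket_add_right: "bracket z (x + y) = bracket z x + bracket z y"
  and bracket_scale_right: "bracket z (scale c x) = scale c (bracket z x)"
  using linear_right[of z] by (simp_all add: Vector_Spaces.linear_iff)

lemma bracket_zero_left: "bracket 0 z = 0"
  using bracket_add_left[of 0 0 z] by simp

lemma bracket_zero_right: "bracket z 0 = 0"
  using bracket_add_right[of z 0 0] by simp

lemma bracket_minus_right: "bracket z (- x) = - bracket z x"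
  using bracket_add_right[of z x "- x"] by (simp add: bracket_zero_right minus_unique)

lemma bracket_sum_right: "bracket z (\<Sum>i\<in>I. g i) = (\<Sum>i\<in>I. bracket z (g i))"
  by (induction I rule: infinite_finite_induct) (auto simp: bracket_zero_right bracket_add_right)

lemma bracket_anticommute: "bracket x y = - bracket y x"
proof -
  have "bracket (x + y) (x + y) = 0" by (rule alternating)
  then have "bracket x y + bracket y x = 0"
    by (simp add: bracket_add_left bracket_add_right alternating[of x] alternating[of y] add.commute)
  then show ?thesis by (simp add: eq_neg_iff_add_eq_0)
qed

lemma bracket_eq_0_commute: "bracket x y = 0 \<longleftrightarrow> bracket y x = 0"
  by (metis bracket_anticommute neg_equal_0_iff_equal)

lemma subspace_lie_center: "subspace (lie_center bracket)"
  by (rule subspaceI)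
    (auto simp: lie_center_def bracket_zero_right bracket_add_right bracket_scale_right)

lemma subspace_second_center: "subspace (second_center bracket)"
  by (rule subspaceI)
    (auto simp: second_center_def bracket_zero_right bracket_add_right bracket_scale_right)

lemma subspace_lie_centralizer: "subspace (lie_centralizer bracket S)"
  by (rule subspaceI)
    (auto simp: lie_centralizer_def bracket_zero_right bracket_add_right bracket_scale_right)

lemma lie_center_subset_second_center: "lie_center bracket \<subseteq> second_center bracket"
  by (auto simp: lie_center_def second_center_def bracket_zero_right)

lemma bracket_second_center: "y \<in> second_center bracket \<Longrightarrow> bracket x y \<in> lie_center bracket"
  by (simp add: lie_center_def second_center_def)

text \<open>For second-central \<open>z\<close>, two of the three terms of the Jacobi identity are
  double brackets ending in \<open>z\<close> up to sign, so they vanish and the third must vanish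
  too. Both the inclusion of the derived algebra and the ideal property follow from this.\<close>

lemma bracket_mem_centralizer_second_center:
  "bracket x y \<in> lie_centralizer bracket (second_center bracket)"
  unfolding lie_centralizer_def
proof (intro CollectI ballI)
  fix z assume z: "z \<in> second_center bracket"
  have "bracket x (bracket y z) = 0" "bracket y (bracket z x) = 0"
    using z bracket_anticommute[of z x] by (simp_all add: second_center_def bracket_minus_right)
  then show "bracket z (bracket x y) = 0"
    using jacobi[of x y z] by simp
qed

lemma derived_algebra_subset:
  "derived_algebra scale bracket \<subseteq> lie_centralizer bracket (second_center bracket)"
  unfolding derived_algebra_def
  by (rule span_minimal[OF _ subspace_lie_centralizer])
    (auto simp: bracket_mem_centralizer_second_center)

text \<open>Apply \<open>D\<close> to [a, [b, x]] = 0 and expand by the Leibniz rule twice: every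
  term except [a, [b, D x]] is again a double bracket ending in \<open>x\<close>.\<close>

lemma derivation_second_center:
  assumes D: "derivation scale bracket D" and x: "x \<in> second_center bracket"
  shows "D x \<in> second_center bracket"
proof -
  have Dbr: "D (bracket u v) = bracket (D u) v + bracket u (D v)" for u v
    using D by (simp add: derivation_def)
  have D0: "D 0 = 0" using Dbr[of 0 0] by (simp add: bracket_zero_left bracket_zero_right)
  have x0: "bracket u (bracket v x) = 0" for u v using x by (simp add: second_center_def)
  have "bracket a (bracket b (D x)) = 0" for a b
    using Dbr[of a "bracket b x"] by (simp add: Dbr[of b x] x0 D0 bracket_add_right)
  then show ?thesis by (simp add: second_center_def)
qed

text \<open>For \<open>y\<close> in the second center and \<open>c\<close> in its centralizer,
  applying \<open>D\<close> to [y, c] = 0 gives [D y, c] + [y, D c] = 0. The first term vanishes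
  because \<open>D y\<close> is second-central again.\<close>

lemma characteristic_centralizer_second_center:
  "characteristic_ideal scale bracket (lie_centralizer bracket (second_center bracket))"
  unfolding characteristic_ideal_def lie_ideal_def
proof (intro conjI allI impI ballI)
  fix D assume D: "derivation scale bracket D"
  have Dbr: "D (bracket u v) = bracket (D u) v + bracket u (D v)" for u v
    using D by (simp add: derivation_def)
  have D0: "D 0 = 0" using Dbr[of 0 0] by (simp add: bracket_zero_left bracket_zero_right)
  show "D ` lie_centralizer bracket (second_center bracket)
      \<subseteq> lie_centralizer bracket (second_center bracket)"
  proof (rule image_subsetI)
    fix c assume c: "c \<in> lie_centralizer bracket (second_center bracket)"
    have "bracket y (D c) = 0" if y: "y \<in> second_center bracket" for y
      using Dbr[of y c] c y derivation_second_center[OF D y]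
      by (simp add: lie_centralizer_def D0)
    then show "D c \<in> lie_centralizer bracket (second_center bracket)"
      by (simp add: lie_centralizer_def)
  qed
qed (rule subspace_lie_centralizer bracket_mem_centralizer_second_center)+

end

section \<open>The pairing and its nondegeneracy\<close>

locale second_center_splitting = fd_lie_algebra scale bracket
  for scale :: "'k::field \<Rightarrow> 'g::ab_group_add \<Rightarrow> 'g" and bracket :: "'g \<Rightarrow> 'g \<Rightarrow> 'g" +
  fixes Z :: 'g and X Y :: "'g set"
  assumes dim_center: "dim (lie_center bracket) = 1"
    and Z_center: "Z \<in> lie_center bracket" and Z_nonzero: "Z \<noteq> 0"
    and subspace_X: "subspace X" and subspace_Y: "subspace Y"
    and second_center_sum: "direct_sum (second_center bracket) (lie_center bracket) Y"
    and UNIV_sum: "direct_sum UNIV X (lie_centralizer bracket (second_center bracket))"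
begin

text \<open>The value is meaningful only when the bracket lies on the line of \<open>Z\<close>. This
  holds for every second-central \<open>y\<close>, while \<open>x\<close> may range over the whole
  algebra and not just over \<open>X\<close>.\<close>

definition pairing :: "'g \<Rightarrow> 'g \<Rightarrow> 'k" where
  "pairing x y = line_coord scale Z (bracket x y)"

lemma center_line: "v \<in> lie_center bracket \<Longrightarrow> \<exists>c. v = scale c Z"
proof -
  assume v: "v \<in> lie_center bracket"
  obtain B where B: "finite B" "independent B" "span B = UNIV"
    by (rule finite_basis_exists)
  interpret fin: finite_dimensional_vector_space scale B by unfold_locales (rule B)+
  \<comment> \<open>As \<open>Z\<close> is nonzero, \<open>{Z}\<close> is an independent set with as
    many elements as the dimension of the center, so it spans.\<close>
  have "lie_center bracket \<subseteq> span {Z}"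
    using Z_center Z_nonzero dim_center by (intro fin.card_ge_dim_independent) auto
  then show ?thesis using v span_singleton by fastforce
qed

lemma line_coord_scale: "line_coord scale Z (scale c Z) = c"
  unfolding line_coord_def using Z_nonzero by (intro the_equality) auto

lemma bracket_eq_pairing:
  assumes "y \<in> second_center bracket"
  shows "bracket x y = scale (pairing x y) Z"
  using center_line[OF bracket_second_center[OF assms]] line_coord_scale
  unfolding pairing_def by metis

text \<open>Coordinates along \<open>Z\<close> are unique. Identities for the pairing are therefore
  proved by writing the bracket as an explicit multiple of \<open>Z\<close>.\<close>

lemma pairing_eqI: "bracket x y = scale c Z \<Longrightarrow> pairing x y = c"
  by (simp add: pairing_def line_coord_scale)

lemma Y_subset: "Y \<subseteq> second_center bracket"
proof
  fix y assume "y \<in> Y"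
  then have "0 + y \<in> second_center bracket"
    using second_center_sum subspace_0[OF subspace_lie_center] unfolding direct_sum_def by blast
  then show "y \<in> second_center bracket" by simp
qed

lemma pairing_add_left:
    "y \<in> Y \<Longrightarrow> pairing (x + x') y = pairing x y + pairing x' y"
  and pairing_scale_left: "y \<in> Y \<Longrightarrow> pairing (scale c x) y = c * pairing x y"
  using Y_subset bracket_eq_pairing
  by (auto intro!: pairing_eqI simp: bracket_add_left bracket_scale_left scale_left_distrib)

lemma pairing_add_right:
    "y \<in> Y \<Longrightarrow> y' \<in> Y \<Longrightarrow> pairing x (y + y') = pairing x y + pairing x y'"
  and pairing_scale_right: "y \<in> Y \<Longrightarrow> pairing x (scale c y) = c * pairing x y"
  using Y_subset bracket_eq_pairing[of _ x]
  by (auto intro!: pairing_eqI simp: bracket_add_right bracket_scale_right scale_left_distrib subset_iff)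

lemma pairing_eq_0_iff: "y \<in> Y \<Longrightarrow> pairing x y = 0 \<longleftrightarrow> bracket x y = 0"
  using bracket_eq_pairing[of y x] Y_subset Z_nonzero by auto

lemma functional_pairing: "y \<in> Y \<Longrightarrow> Vector_Spaces.linear scale (*) (\<lambda>x. pairing x y)"
  by (simp add: functional_iff pairing_add_left pairing_scale_left)

text \<open>A second-central element is the sum of a central one and one from \<open>Y\<close>, and
  the central summand commutes with everything.\<close>

lemma centralizer_Y: "lie_centralizer bracket Y = lie_centralizer bracket (second_center bracket)"
proof
  show "lie_centralizer bracket (second_center bracket) \<subseteq> lie_centralizer bracket Y"
    using Y_subset by (auto simp: lie_centralizer_def)
  show "lie_centralizer bracket Y \<subseteq> lie_centralizer bracket (second_center bracket)"
  proof
    fix x assume x: "x \<in> lie_centralizer bracket Y"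
    have "bracket s x = 0" if "s \<in> second_center bracket" for s
    proof -
      obtain z y where s: "s = z + y" "z \<in> lie_center bracket" "y \<in> Y"
        using \<open>s \<in> _\<close> second_center_sum unfolding direct_sum_def by auto
      have "bracket z x = 0" using s(2) bracket_eq_0_commute by (auto simp: lie_center_def)
      then show ?thesis using x s by (simp add: lie_centralizer_def bracket_add_left)
    qed
    then show "x \<in> lie_centralizer bracket (second_center bracket)"
      by (simp add: lie_centralizer_def)
  qed
qed

text \<open>This presents the centralizer as the left kernel of the pairing on the whole algebra,
  which ties both nondegeneracy and the annihilator to the functionals given by
  \<open>Y\<close>.\<close>

lemma mem_centralizer_iff:
  "x \<in> lie_centralizer bracket (second_center bracket) \<longleftrightarrow> (\<forall>y\<in>Y. pairing x y = 0)"
proof -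
  have "x \<in> lie_centralizer bracket Y \<longleftrightarrow> (\<forall>y\<in>Y. bracket x y = 0)"
    unfolding lie_centralizer_def mem_Collect_eq bracket_eq_0_commute[of x] ..
  then show ?thesis by (simp add: centralizer_Y pairing_eq_0_iff)
qed

text \<open>Such an \<open>x\<close> lies in the left kernel, that is, in the centralizer, which
  meets \<open>X\<close> only in 0.\<close>

lemma X_eq_0:
  assumes "x \<in> X" and "\<And>y. y \<in> Y \<Longrightarrow> pairing x y = 0"
  shows "x = 0"
proof -
  have "x \<in> lie_centralizer bracket (second_center bracket)"
    unfolding mem_centralizer_iff by (intro ballI assms(2))
  then show ?thesis using assms(1) UNIV_sum by (auto simp: direct_sum_def)
qed

text \<open>Every vector splits into a part in \<open>X\<close> and a part commuting with
  \<open>y\<close>. Pairing to zero with \<open>X\<close> thus makes \<open>y\<close> central, and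
  \<open>Y\<close> meets the center only in 0.\<close>

lemma Y_eq_0:
  assumes y: "y \<in> Y" and 0: "\<And>x. x \<in> X \<Longrightarrow> pairing x y = 0"
  shows "y = 0"
proof -
  have "bracket v y = 0" for v
  proof -
    obtain x c where v: "v = x + c" "x \<in> X" "c \<in> lie_centralizer bracket (second_center bracket)"
      using UNIV_sum unfolding direct_sum_def by blast
    then have "pairing v y = 0" using 0 y mem_centralizer_iff by (simp add: pairing_add_left)
    then show ?thesis using y pairing_eq_0_iff by blast
  qed
  then have "y \<in> lie_center bracket" by (simp add: lie_center_def)
  then show ?thesis using y second_center_sum by (auto simp: direct_sum_def)
qed

lemma duality_pairing_X_Y: "duality_pairing scale X Y pairing"
  unfolding duality_pairing_def
  by (intro conjI ballI allI impI X_eq_0 Y_eq_0 pairing_add_left pairing_add_right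
      pairing_scale_left pairing_scale_right) blast+

section \<open>The dual bases attached to a basis of \<open>Y\<close>\<close>

context
  fixes Ys :: "'g list"
  assumes Ys: "ordered_basis scale Y Ys"
begin

lemma Ys_nth_mem: "k < length Ys \<Longrightarrow> Ys ! k \<in> Y"
  by (rule ordered_basis_nth_mem[OF vector_space_axioms Ys])

lemma functional_pairing_nth:
  "k < length Ys \<Longrightarrow> Vector_Spaces.linear scale (*) (\<lambda>x. pairing x (Ys ! k))"
  by (intro functional_pairing Ys_nth_mem)

lemma bracket_nth: "k < length Ys \<Longrightarrow> bracket x (Ys ! k) = scale (pairing x (Ys ! k)) Z"
  using bracket_eq_pairing Ys_nth_mem Y_subset by blast

lemma pairing_eq_0_basis:
  assumes "\<And>k. k < length Ys \<Longrightarrow> pairing x (Ys ! k) = 0" and "y \<in> Y"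
  shows "pairing x y = 0"
proof -
  have "subspace {y. bracket x y = 0}"
    by (rule subspaceI) (auto simp: bracket_zero_right bracket_add_right bracket_scale_right)
  moreover have "set Ys \<subseteq> {y. bracket x y = 0}"
    using assms(1) bracket_nth by (auto simp: in_set_conv_nth)
  ultimately have "span (set Ys) \<subseteq> {y. bracket x y = 0}" by (intro span_minimal)
  then show ?thesis
    using Ys assms(2) pairing_eq_0_iff by (auto simp: ordered_basis_def)
qed

lemma dual_list_exists:
  "\<exists>Xs. length Xs = length Ys \<and> set Xs \<subseteq> X \<and> (\<forall>j<length Ys. \<forall>k<length Ys.
    pairing (Xs ! j) (Ys ! k) = (if j = k then 1 else 0))"
proof -
  have "\<exists>x. \<forall>j<length Ys. x j \<in> X \<and>
      (\<forall>k<length Ys. pairing (x j) (Ys ! k) = (if j = k then 1 else 0))"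
  \<comment> \<open>What remains is that the functionals given by the basis are independent on
    \<open>X\<close>. A relation with coefficients \<open>c\<close> says that the combination
    \<open>?y\<close> pairs to zero with all of \<open>X\<close>; then \<open>?y\<close> is zero and
    so are its coefficients.\<close>
  proof (rule biorthogonal_family_exists[OF subspace_X functional_pairing_nth])
    fix c k assume 0: "\<And>x. x \<in> X \<Longrightarrow> (\<Sum>k<length Ys. c k * pairing x (Ys ! k)) = 0"
      and k: "k < length Ys"
    let ?y = "\<Sum>k<length Ys. scale (c k) (Ys ! k)"
    have "?y \<in> Y"
      by (intro subspace_sum[OF subspace_Y] subspace_scale[OF subspace_Y] Ys_nth_mem) simp
    moreover have "pairing x ?y = 0" if "x \<in> X" for x
    proof -
      have "bracket x ?y = scale (\<Sum>k<length Ys. c k * pairing x (Ys ! k)) Z"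
        by (simp add: bracket_sum_right bracket_scale_right bracket_nth scale_sum_left)
      then show ?thesis using 0[OF that] by (intro pairing_eqI) simp
    qed
    ultimately have "?y = 0" by (rule Y_eq_0)
    then show "c k = 0" using ordered_basis_coeff_zero[OF Ys _ k] by blast
  qed
  then obtain x where "\<forall>j<length Ys. x j \<in> X \<and>
      (\<forall>k<length Ys. pairing (x j) (Ys ! k) = (if j = k then 1 else 0))" ..
  then show ?thesis by (intro exI[of _ "map x [0..<length Ys]"]) auto
qed

lemma ordered_basis_dual_list:
  assumes "length Xs = length Ys" and "set Xs \<subseteq> X"
    and "\<forall>j<length Ys. \<forall>k<length Ys. pairing (Xs ! j) (Ys ! k) = (if j = k then 1 else 0)"
  shows "ordered_basis scale X Xs"
proof (rule ordered_basis_biorthogonal[where f = "\<lambda>k x. pairing x (Ys ! k)"])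
  fix x assume "x \<in> X" and "\<And>k. k < length Xs \<Longrightarrow> pairing x (Ys ! k) = 0"
  then show "x = 0" by (intro X_eq_0[OF _ pairing_eq_0_basis]) (simp_all add: assms(1))
qed (use assms functional_pairing_nth subspace_X in simp_all)

lemma dim_X_eq_dim_Y: "dim X = dim Y"
proof -
  obtain Xs where "length Xs = length Ys" "set Xs \<subseteq> X"
    "\<forall>j<length Ys. \<forall>k<length Ys. pairing (Xs ! j) (Ys ! k) = (if j = k then 1 else 0)"
    using dual_list_exists by blast
  then show ?thesis
    using length_ordered_basis[OF ordered_basis_dual_list] length_ordered_basis[OF Ys] by simp
qed

text \<open>Uniqueness is nondegeneracy on the left: entries of two candidates at the same position
  differ by an element of \<open>X\<close> that pairs to zero with the basis of
  \<open>Y\<close>.\<close>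

lemma ex1_dual_basis:
  "\<exists>!Xs. ordered_basis scale X Xs \<and> length Xs = length Ys \<and>
    (\<forall>j<length Ys. \<forall>k<length Ys. bracket (Xs ! j) (Ys ! k) = (if j = k then Z else 0))"
proof -
  obtain Xs where Xs: "length Xs = length Ys" "set Xs \<subseteq> X"
    "\<forall>j<length Ys. \<forall>k<length Ys. pairing (Xs ! j) (Ys ! k) = (if j = k then 1 else 0)"
    using dual_list_exists by blast
  show ?thesis
  proof (rule ex1I[of _ Xs])
    show "ordered_basis scale X Xs \<and> length Xs = length Ys \<and>
      (\<forall>j<length Ys. \<forall>k<length Ys. bracket (Xs ! j) (Ys ! k) = (if j = k then Z else 0))"
      using ordered_basis_dual_list[OF Xs] Xs by (simp add: bracket_nth)
    fix Xs' assume Xs': "ordered_basis scale X Xs' \<and> length Xs' = length Ys \<and>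
      (\<forall>j<length Ys. \<forall>k<length Ys. bracket (Xs' ! j) (Ys ! k) = (if j = k then Z else 0))"
    show "Xs' = Xs"
    proof (rule nth_equalityI)
      show "length Xs' = length Xs" using Xs' Xs by simp
      fix j assume "j < length Xs'"
      then have j: "j < length Ys" using Xs' by simp
      have mem: "Xs' ! j - Xs ! j \<in> X"
        using Xs' Xs j ordered_basis_nth_mem[OF vector_space_axioms, of X Xs' j]
        by (intro subspace_diff[OF subspace_X]) auto
      have "pairing (Xs' ! j - Xs ! j) (Ys ! k) = 0" if k: "k < length Ys" for k
      proof -
        have "pairing (Xs' ! j) (Ys ! k) = (if j = k then 1 else 0)"
          using Xs' j k by (intro pairing_eqI) auto
        then show ?thesis
          using Xs(3) j k functional_diff[OF functional_pairing_nth[OF k]] by simp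
      qed
      then have "Xs' ! j - Xs ! j = 0" by (rule X_eq_0[OF mem pairing_eq_0_basis])
      then show "Xs' ! j = Xs ! j" by simp
    qed
  qed
qed

text \<open>The bracket condition already fixes each functional, since coordinates along
  \<open>Z\<close> are unique. The content is that these functionals form a basis of the
  annihilator.\<close>

lemma ex1_annihilator_basis:
  "\<exists>!\<gamma>s. ordered_basis dual_scale
      (annihilator scale (lie_centralizer bracket (second_center bracket))) \<gamma>s \<and>
    length \<gamma>s = length Ys \<and>
    (\<forall>k<length Ys. \<forall>x. bracket x (Ys ! k) = scale ((\<gamma>s ! k) x) Z)"
proof -
  let ?A = "annihilator scale (lie_centralizer bracket (second_center bracket))"
  obtain Xs where Xs: "length Xs = length Ys" "set Xs \<subseteq> X"
    "\<forall>j<length Ys. \<forall>k<length Ys. pairing (Xs ! j) (Ys ! k) = (if j = k then 1 else 0)"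
    using dual_list_exists by blast
  define \<gamma>s where "\<gamma>s = map (\<lambda>y x. pairing x y) Ys"
  have \<gamma>: "(\<gamma>s ! k) x = pairing x (Ys ! k)" if "k < length Ys" for k x
    using that by (simp add: \<gamma>s_def)
  have len: "length \<gamma>s = length Ys" by (simp add: \<gamma>s_def)
  have "ordered_basis dual_scale ?A \<gamma>s"
  \<comment> \<open>The roles are exchanged: the vectors are now functionals on the algebra, and the
    biorthogonal functionals on them are the evaluations at the dual vectors
    \<open>Xs ! k\<close>.\<close>
  proof (rule dual.ordered_basis_biorthogonal[where f = "\<lambda>k \<gamma>. \<gamma> (Xs ! k)"])
    show "dual.subspace ?A" by (rule subspace_annihilator)
    show "set \<gamma>s \<subseteq> ?A"
    proof
      fix \<gamma> assume "\<gamma> \<in> set \<gamma>s"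
      then obtain k where k: "k < length Ys" "\<gamma> = (\<lambda>x. pairing x (Ys ! k))"
        by (auto simp: \<gamma>s_def in_set_conv_nth)
      then show "\<gamma> \<in> ?A"
        using functional_pairing_nth Ys_nth_mem by (simp add: annihilator_def mem_centralizer_iff)
    qed
    show "Vector_Spaces.linear dual_scale (*) (\<lambda>\<gamma>. \<gamma> (Xs ! k))" for k
      by (simp add: dual.functional_iff dual_scale_def)
    show "(\<gamma>s ! j) (Xs ! k) = (if j = k then 1 else 0)" if "j < length \<gamma>s" "k < length \<gamma>s" for j k
      using that Xs(3) by (auto simp: len \<gamma>)
    fix \<gamma> assume mem: "\<gamma> \<in> ?A" and 0: "\<And>k. k < length \<gamma>s \<Longrightarrow> \<gamma> (Xs ! k) = 0"
    have lin: "Vector_Spaces.linear scale (*) \<gamma>" using mem by (simp add: annihilator_def)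
    show "\<gamma> = 0"
    proof
      fix x
      \<comment> \<open>Here \<open>?s\<close> is the component of \<open>x\<close> in
        \<open>X\<close>. The remainder lies in the centralizer, where \<open>\<gamma>\<close>
        vanishes by definition of the annihilator, and \<open>\<gamma>\<close> vanishes on
        \<open>?s\<close> by the assumption on the evaluations.\<close>
      let ?s = "\<Sum>j<length Ys. scale (pairing x (Ys ! j)) (Xs ! j)"
      have "pairing (x - ?s) (Ys ! k) = 0" if "k < length Ys" for k
        using functional_biorthogonal_combination[of "length Ys" "\<lambda>k x. pairing x (Ys ! k)" "(!) Xs" k x]
          functional_pairing_nth Xs(3) that by simp
      from pairing_eq_0_basis[OF this]
      have "x - ?s \<in> lie_centralizer bracket (second_center bracket)"
        unfolding mem_centralizer_iff by (rule ballI)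
      then have "\<gamma> (x - ?s) = 0" using mem by (simp add: annihilator_def)
      then show "\<gamma> x = 0 x"
        using 0 by (simp add: functional_diff[OF lin] functional_sum[OF lin] functional_scale[OF lin] len)
    qed
  qed
  then show ?thesis
  proof (intro ex1I[of _ \<gamma>s])
    fix \<gamma>s' assume \<gamma>s': "ordered_basis dual_scale ?A \<gamma>s' \<and> length \<gamma>s' = length Ys \<and>
      (\<forall>k<length Ys. \<forall>x. bracket x (Ys ! k) = scale ((\<gamma>s' ! k) x) Z)"
    show "\<gamma>s' = \<gamma>s"
    proof (rule nth_equalityI)
      show "length \<gamma>s' = length \<gamma>s" using \<gamma>s' len by simp
      fix k assume "k < length \<gamma>s'"
      then have k: "k < length Ys" using \<gamma>s' by simp
      show "\<gamma>s' ! k = \<gamma>s ! k"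
      proof
        fix x
        have "pairing x (Ys ! k) = (\<gamma>s' ! k) x" using \<gamma>s' k by (intro pairing_eqI) blast
        then show "(\<gamma>s' ! k) x = (\<gamma>s ! k) x" using \<gamma>[OF k] by simp
      qed
    qed
  qed (simp add: len \<gamma> bracket_nth)
qed

end

section \<open>Dimension formulas\<close>

lemma dimension_formulas:
  "quotient_dim scale UNIV (lie_centralizer bracket (second_center bracket)) =
    quotient_dim scale (second_center bracket) (lie_center bracket)" (is ?quotient)
  "dim (second_center bracket) + dim (lie_centralizer bracket (second_center bracket)) =
    dim (UNIV :: 'g set) + 1" (is ?dims)
proof -
  obtain B where B: "finite B" "independent B" "span B = UNIV"
    by (rule finite_basis_exists)
  interpret fin: finite_dimensional_vector_space scale B by unfold_locales (rule B)+
  obtain Ys where "ordered_basis scale Y Ys"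
    using ordered_basis_exists[OF B(1,3) subspace_Y] by blast
  then have XY: "dim X = dim Y" by (rule dim_X_eq_dim_Y)
  \<comment> \<open>The two splittings express the dimensions through those of \<open>X\<close> and
    \<open>Y\<close>, which agree. The summand 1 in the second formula is the dimension of the
    center.\<close>
  note sums = fin.dim_direct_sum[OF subspace_X subspace_lie_centralizer UNIV_sum]
    fin.dim_direct_sum[OF subspace_lie_center subspace_Y second_center_sum]
  then show ?dims using XY dim_center by simp
  have "quotient_dim scale UNIV (lie_centralizer bracket (second_center bracket)) +
      dim (lie_centralizer bracket (second_center bracket)) = dim (UNIV :: 'g set)"
    using B by (intro quotient_dim_eq[of _ _ B] subspace_lie_centralizer) auto
  moreover have "quotient_dim scale (second_center bracket) (lie_center bracket) +
      dim (lie_center bracket) = dim (second_center bracket)"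
    using B lie_center_subset_second_center
    by (intro quotient_dim_eq[of _ _ B] subspace_lie_center subspace_second_center) auto
  ultimately show ?quotient using sums XY by simp
qed

end

theorem theorem3p1:
  fixes scale :: "'k::field \<Rightarrow> 'g::ab_group_add \<Rightarrow> 'g"
    and bracket :: "'g \<Rightarrow> 'g \<Rightarrow> 'g"
    and Z :: 'g and X Y :: "'g set"
  assumes "fd_lie_algebra scale bracket"
    and "CHAR('k) \<noteq> 2"
    and "vector_space.dim scale (lie_center bracket) = 1"
    and "Z \<in> lie_center bracket" and "Z \<noteq> 0"
    and "module.subspace scale X" and "module.subspace scale Y"
    and "direct_sum (second_center bracket) (lie_center bracket) Y"
    and "direct_sum UNIV X (lie_centralizer bracket (second_center bracket))"
    and "direct_sum UNIV X (lie_centralizer bracket Y)"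
  shows
    "((\<forall>x\<in>X. \<forall>y\<in>Y. bracket x y \<in> lie_center bracket) \<and>
      duality_pairing scale X Y (\<lambda>x y. line_coord scale Z (bracket x y)) \<and>
      quotient_dim scale UNIV (lie_centralizer bracket (second_center bracket)) =
        quotient_dim scale (second_center bracket) (lie_center bracket) \<and>
      vector_space.dim scale (second_center bracket) +
        vector_space.dim scale (lie_centralizer bracket (second_center bracket)) =
        vector_space.dim scale (UNIV :: 'g set) + 1) \<and>
     (\<forall>Ys. ordered_basis scale Y Ys \<longrightarrow>
      (\<exists>!Xs. ordered_basis scale X Xs \<and> length Xs = length Ys \<and>
        (\<forall>j<length Ys. \<forall>k<length Ys.
          bracket (Xs ! j) (Ys ! k) = (if j = k then Z else 0))) \<and>
      (\<exists>!\<gamma>s. ordered_basis dual_scale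
          (annihilator scale (lie_centralizer bracket (second_center bracket))) \<gamma>s \<and>
        length \<gamma>s = length Ys \<and>
        (\<forall>k<length Ys. \<forall>x. bracket x (Ys ! k) = scale ((\<gamma>s ! k) x) Z))) \<and>
     (derived_algebra scale bracket \<subseteq> lie_centralizer bracket (second_center bracket) \<and>
      characteristic_ideal scale bracket (lie_centralizer bracket (second_center bracket)))"
proof -
  interpret fd_lie_algebra scale bracket by fact
  interpret second_center_splitting scale bracket Z X Y
    by unfold_locales (use assms in auto)
  have "\<forall>x\<in>X. \<forall>y\<in>Y. bracket x y \<in> lie_center bracket"
    using bracket_second_center Y_subset by blast
  moreover have "duality_pairing scale X Y (\<lambda>x y. line_coord scale Z (bracket x y))"
    using duality_pairing_X_Y by (simp add: pairing_def[abs_def])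
  ultimately show ?thesis
    by (intro conjI allI impI dimension_formulas ex1_dual_basis ex1_annihilator_basis
        derived_algebra_subset characteristic_centralizer_second_center)
qed

end
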